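(* Let $n,p\ge 1$ be integers, let $X\in\mathbb{R}^{n\times p}$ be a matrix with $X^\top X$ invertible, and let $Q = I_n - X(X^\top X)^{-1}X^\top$. If the Hadamard product $Q\odot Q$ is invertible, then $$n \ge p + \frac12 + \sqrt{2p+\frac14}.$$
   Context: $I_n$ is the $n\times n$ identity matrix. For a matrix $M$, $M\odot M$ denotes the Hadamard (entrywise) product of $M$ with itself, i.e. $(M\odot M)_{ij}=M_{ij}^2$. *)

theory Defs
  imports "HOL-Analysis.Analysis"
begin

definition hadamard_product :: "'a::times^'n^'m \<Rightarrow> 'a^'n^'m \<Rightarrow> 'a^'n^'m"
  (infixl \<open>\<odot>\<close> 70)
  where "A \<odot> B = (\<chi> i j. A $ i $ j * B $ i $ j)"

end

theory Submission
  imports Defs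
begin

text \<open>
  The matrix \<open>Q\<close> projects onto the orthogonal complement of the column space of \<open>X\<close>, so its
  rank \<open>r\<close> satisfies \<open>r + p \<le> n\<close>. The columns of \<open>Q \<odot> Q\<close> are the entrywise squares of vectors of an
  \<open>r\<close>-dimensional space. Because the entrywise product is bilinear and symmetric, these squares are
  combinations of the products \<open>b\<^sub>i b\<^sub>j\<close> with \<open>i \<le> j\<close> of basis vectors, of which there are
  \<open>r (r + 1) / 2\<close>: this is \<open>rank_hadamard_square\<close>. If \<open>Q \<odot> Q\<close> is invertible, its rank is \<open>n\<close>, hence
  \<open>2 n \<le> r\<^sup>2 + r\<close>. Substituting \<open>r \<le> n - p\<close> turns this into a quadratic inequality in \<open>n - p\<close>, and
  the claimed bound is its larger root; the other range of solutions is excluded because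
  \<open>n - p \<ge> r \<ge> 1\<close>.
\<close>

text \<open>The bound counts a basis \<open>b\<^sub>0, \<dots>, b\<^bsub>r-1\<^esub>\<close> of the span of \<open>S\<close> in pairs: as the product commutes,
  only the pairs with \<open>i \<le> j\<close> contribute.\<close>

lemma dim_products_le:
  fixes S :: "'a::euclidean_space set" and f :: "'a \<Rightarrow> 'a \<Rightarrow> 'b::euclidean_space"
  assumes bil: "bilinear f" and comm: "\<And>x y. f x y = f y x"
  shows "dim {f v w |v w. v \<in> S \<and> w \<in> S} \<le> dim S * (dim S + 1) div 2"
proof -
  obtain B where B: "S \<subseteq> span B" "finite B" "card B = dim S"
    using basis_exists[of S] finiteI_independent by metis
  obtain b where b: "B = b ` {0..<dim S}"
    using ex_bij_betw_nat_finite[OF B(2)] B(3) by (metis bij_betw_imp_surj_on)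
  define I where "I = (SIGMA j:{0..<dim S}. {0..j})"
  define P where "P = (\<lambda>(j, i). f (b i) (b j)) ` I"
  have "finite I" unfolding I_def by simp
  have gauss: "(\<Sum>j = 0..<m. Suc j) = m * (m + 1) div 2" for m
    by (induction m) auto
  have "card I = (\<Sum>j = 0..<dim S. Suc j)"
    unfolding I_def by (subst card_SigmaI) auto
  also have "\<dots> = dim S * (dim S + 1) div 2"
    by (rule gauss)
  finally have card_P: "card P \<le> dim S * (dim S + 1) div 2"
    unfolding P_def using card_image_le[OF \<open>finite I\<close>] by metis
  have lin_left: "linear (\<lambda>x. f x y)" and lin_right: "linear (f x)" for x y
    using bil unfolding bilinear_def by auto
  have ordered: "f (b i) (b j) \<in> P" if "i \<le> j" "j < dim S" for i j
    unfolding P_def I_def using that by force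
  have "f (b i) (b j) \<in> P" if "i < dim S" "j < dim S" for i j
    using that ordered[of i j] ordered[of j i] comm[of "b i" "b j"] by (cases "i \<le> j") auto
  then have basis: "f x y \<in> span P" if "x \<in> B" "y \<in> B" for x y
    using that unfolding b by (auto intro: span_base)
  have half: "f x y \<in> span P" if "x \<in> span B" "y \<in> B" for x y
  proof -
    have "subspace {x. f x y \<in> span P}"
      using linear_subspace_vimage[OF lin_left subspace_span[of P]] by (simp add: vimage_def)
    then show ?thesis
      using span_induct[OF that(1), of "\<lambda>x. f x y \<in> span P"] basis[OF _ that(2)] by blast
  qed
  have full: "f x y \<in> span P" if "x \<in> span B" "y \<in> span B" for x y
  proof -
    have "subspace {y. f x y \<in> span P}"
      using linear_subspace_vimage[OF lin_right subspace_span[of P]] by (simp add: vimage_def)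
    then show ?thesis
      using span_induct[OF that(2), of "\<lambda>y. f x y \<in> span P"] half[OF that(1)] by blast
  qed
  have "{f v w |v w. v \<in> S \<and> w \<in> S} \<subseteq> span P"
    using full B(1) by blast
  moreover have "finite P"
    unfolding P_def using \<open>finite I\<close> by simp
  ultimately have "dim {f v w |v w. v \<in> S \<and> w \<in> S} \<le> card P"
    by (rule dim_le_card)
  then show ?thesis
    using card_P by simp
qed

lemma rank_hadamard_square:
  fixes A :: "real^'n^'m"
  shows "rank (A \<odot> A) \<le> rank A * (rank A + 1) div 2"
proof -
  define f :: "real^'m \<Rightarrow> real^'m \<Rightarrow> real^'m" where "f v w = (\<chi> i. v $ i * w $ i)" for v w
  have "bilinear f"
    unfolding bilinear_def f_def
    by (auto intro!: linearI simp: vec_eq_iff algebra_simps)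
  moreover have "f v w = f w v" for v w
    unfolding f_def by (simp add: mult.commute)
  ultimately have "dim {f v w |v w. v \<in> columns A \<and> w \<in> columns A} \<le> rank A * (rank A + 1) div 2"
    unfolding column_rank_def by (rule dim_products_le)
  moreover have "column j (A \<odot> A) = f (column j A) (column j A)" for j
    unfolding f_def column_def hadamard_product_def by simp
  then have "columns (A \<odot> A) \<subseteq> {f v w |v w. v \<in> columns A \<and> w \<in> columns A}"
    unfolding columns_def by auto
  then have "rank (A \<odot> A) \<le> dim {f v w |v w. v \<in> columns A \<and> w \<in> columns A}"
    unfolding column_rank_def by (rule dim_subset)
  ultimately show ?thesis
    by simp
qed

text \<open>The hypothesis says that the two column spaces are orthogonal, so their dimensions add up
  inside the ambient space.\<close>

lemma rank_add_le_of_transpose_mult_eq_0: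
  fixes A :: "real^'m^'n" and B :: "real^'k^'n"
  assumes "transpose A ** B = 0"
  shows "rank A + rank B \<le> CARD('n)"
proof -
  have "column i A \<bullet> column j B = (transpose A ** B) $ i $ j" for i j
    by (simp add: matrix_matrix_mult_def inner_vec_def column_def transpose_def)
  then have "x \<bullet> y = 0" if "x \<in> columns A" "y \<in> columns B" for x y
    using that assms unfolding columns_def by auto
  then have "dim (columns A) + dim (columns B) = dim (columns A \<union> columns B)"
    by (simp add: dim_orthogonal_sum)
  also have "\<dots> \<le> CARD('n)"
    using dim_subset_UNIV[of "columns A \<union> columns B"] by simp
  finally show ?thesis
    by (simp add: column_rank_def)
qed

lemma rank_invertible:
  fixes A :: "real^'n^'n"
  assumes "invertible A"
  shows "rank A = CARD('n)"
  using assms det_eq_0_rank[of A] rank_bound[of A] by (simp add: invertible_det_nz)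

theorem mainTheorem1:
  fixes X :: "real^'p^'n" and Q :: "real^'n^'n"
  assumes "invertible (transpose X ** X)"
    and "Q = mat 1 - X ** matrix_inv (transpose X ** X) ** transpose X"
    and "invertible (Q \<odot> Q)"
  shows "real CARD('n) \<ge> real CARD('p) + 1 / 2 + sqrt (2 * real CARD('p) + 1 / 4)"
proof -
  define G where "G = transpose X ** X"
  have G: "G ** matrix_inv G = mat 1"
    using assms(1) unfolding G_def invertible_def matrix_inv_def by (rule someI2_ex) auto
  have "transpose X ** (A - B) = transpose X ** A - transpose X ** B" for A B :: "real^'n^'n"
    by (simp add: vec_eq_iff matrix_matrix_mult_def right_diff_distrib sum_subtractf)
  then have "transpose X ** Q = transpose X - G ** matrix_inv G ** transpose X"
    unfolding assms(2) G_def by (simp add: matrix_mul_assoc)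
  then have "transpose X ** Q = 0"
    by (simp add: G)
  then have sum_le: "rank X + rank Q \<le> CARD('n)"
    by (rule rank_add_le_of_transpose_mult_eq_0)
  have rank_X: "rank X = CARD('p)"
    using rank_invertible[OF assms(1)] rank_mul_le_right[of "transpose X" X] rank_bound[of X]
    by simp
  define r where "r = rank Q"
  have n_le: "CARD('n) \<le> r * (r + 1) div 2"
    using rank_hadamard_square[of Q] rank_invertible[OF assms(3)] by (simp add: r_def)
  have "0 < CARD('n)"
    by simp
  with n_le have "r \<noteq> 0"
    by (cases r) auto
  define s where "s = real CARD('n) - real CARD('p)"
  have r_le: "real r \<le> s"
    using sum_le unfolding rank_X s_def r_def by linarith
  have s_ge: "1 \<le> s"
    using r_le \<open>r \<noteq> 0\<close> by linarith
  have "2 * CARD('n) \<le> r * (r + 1)"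
    using n_le by linarith
  then have "2 * real CARD('n) \<le> real r * (real r + 1)"
    by (metis of_nat_le_iff of_nat_mult of_nat_add of_nat_1 of_nat_numeral)
  also have "\<dots> \<le> s * (s + 1)"
    using r_le by (intro mult_mono) auto
  finally have "2 * real CARD('p) + 1 / 4 \<le> (s - 1 / 2)\<^sup>2"
    unfolding s_def by (simp add: power2_eq_square algebra_simps)
  then have "sqrt (2 * real CARD('p) + 1 / 4) \<le> s - 1 / 2"
    using s_ge by (intro real_le_lsqrt) auto
  then show ?thesis
    unfolding s_def by linarith
qed

end
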